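(* Let $\mathscr H$ be a complex Hilbert space and let $\mathfrak M$ be a nonempty set of bounded self-adjoint operators on $\mathscr H$ that is bounded from below. If the operators of $\mathfrak M$ commute pairwise, then the set $\mathfrak L^{com}$ of all lower bounds of $\mathfrak M$ that commute with every element of $\mathfrak M$ has a greatest element.
   Context: $\mathfrak S$ denotes the real vector space of bounded self-adjoint operators on $\mathscr H$, with Löwner's order: $S\le T$ iff $(Su,u)\le (Tu,u)$ for all $u\in\mathscr H$. An operator $L\in\mathfrak S$ is a lower bound of $\mathfrak M$ if $L\le A$ for all $A\in\mathfrak M$; $\mathfrak M$ is bounded from below if it has a lower bound. $\mathfrak L^{com}=\{L\in\mathfrak S: L\le A\text{ and }AL=LA\text{ for all }A\in\mathfrak M\}$. A greatest element of $\mathfrak L^{com}$ is $G\in\mathfrak L^{com}$ with $L\le G$ for all $L\in\mathfrak L^{com}$. *)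

theory Defs
  imports "HOL-Analysis.Analysis"
begin

(* The library has no complex inner product spaces.  The class below extends real_inner,
   so that norm, metric and topology are those of the underlying real space, whose inner
   product is the real part of the complex one.  Positive definiteness of cinner is thereby
   inherited from real_inner; see cinner_self.  The inner product is linear in its first
   argument. *)
class complex_inner = real_inner +
  fixes scaleC :: "complex \<Rightarrow> 'a \<Rightarrow> 'a"  (infixr \<open>*\<^sub>C\<close> 75)
    and cinner :: "'a \<Rightarrow> 'a \<Rightarrow> complex"
  assumes scaleC_add_right: "c *\<^sub>C (x + y) = c *\<^sub>C x + c *\<^sub>C y"
    and scaleC_add_left: "(c + d) *\<^sub>C x = c *\<^sub>C x + d *\<^sub>C x"
    and scaleC_scaleC: "c *\<^sub>C d *\<^sub>C x = (c * d) *\<^sub>C x"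
    and scaleC_one: "1 *\<^sub>C x = x"
    and scaleR_scaleC: "r *\<^sub>R x = complex_of_real r *\<^sub>C x"
    and cinner_add_left: "cinner (x + y) z = cinner x z + cinner y z"
    and cinner_scaleC_left: "cinner (c *\<^sub>C x) y = c * cinner x y"
    and cinner_commute: "cinner x y = cnj (cinner y x)"
    and inner_eq_Re_cinner: "inner x y = Re (cinner x y)"

lemma cinner_self: "cinner x x = complex_of_real ((norm x)\<^sup>2)"
proof -
  have "Im (cinner x x) = 0"
    using arg_cong[OF cinner_commute[of x x], of Im] by simp
  then show ?thesis
    by (simp add: complex_eq_iff power2_norm_eq_inner inner_eq_Re_cinner)
qed

class complex_hilbert_space = complex_inner + complete_space

instantiation complex :: complex_hilbert_space
begin

definition scaleC_complex :: "complex \<Rightarrow> complex \<Rightarrow> complex"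
  where "scaleC_complex c x = c * x"

definition cinner_complex :: "complex \<Rightarrow> complex \<Rightarrow> complex"
  where "cinner_complex x y = x * cnj y"

instance
  by standard
    (auto simp: scaleC_complex_def cinner_complex_def inner_complex_def scaleR_conv_of_real
      algebra_simps)

end

(* A blinfun is bounded and real-linear, so complex linearity amounts to complex homogeneity. *)
definition self_adjoint_ops :: "('a::complex_hilbert_space \<Rightarrow>\<^sub>L 'a) set"
  where "self_adjoint_ops =
    {S :: 'a \<Rightarrow>\<^sub>L 'a. (\<forall>c x. S (c *\<^sub>C x) = c *\<^sub>C S x) \<and> (\<forall>u v. cinner (S u) v = cinner u (S v))}"

(* For self-adjoint S the number cinner (S u) u is real; Re only adjusts the type. *)
definition loewner_le ::
    "('a::complex_hilbert_space \<Rightarrow>\<^sub>L 'a) \<Rightarrow> ('a \<Rightarrow>\<^sub>L 'a) \<Rightarrow> bool"  (infix \<open>\<le>\<^sub>L\<close> 50)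
  where "S \<le>\<^sub>L T \<longleftrightarrow> (\<forall>u. Re (cinner (S u) u) \<le> Re (cinner (T u) u))"

lemma cinner_self_adjoint_real:
  assumes "S \<in> self_adjoint_ops"
  shows "cinner (S u) u \<in> \<real>"
proof -
  have "cinner (S u) u = cnj (cinner (S u) u)"
    using assms cinner_commute[of u "S u"] by (simp add: self_adjoint_ops_def)
  then show ?thesis
    by (metis Reals_cnj_iff)
qed

definition lower_bounds :: "('a::complex_hilbert_space \<Rightarrow>\<^sub>L 'a) set \<Rightarrow> ('a \<Rightarrow>\<^sub>L 'a) set"
  where "lower_bounds M = {L \<in> self_adjoint_ops. \<forall>A\<in>M. L \<le>\<^sub>L A}"

definition bounded_from_below :: "('a::complex_hilbert_space \<Rightarrow>\<^sub>L 'a) set \<Rightarrow> bool"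
  where "bounded_from_below M \<longleftrightarrow> (\<exists>L. L \<in> lower_bounds M)"

definition commuting_lower_bounds ::
    "('a::complex_hilbert_space \<Rightarrow>\<^sub>L 'a) set \<Rightarrow> ('a \<Rightarrow>\<^sub>L 'a) set"
  where "commuting_lower_bounds M = {L \<in> lower_bounds M. \<forall>A\<in>M. A o\<^sub>L L = L o\<^sub>L A}"

definition greatest_element ::
    "('a::complex_hilbert_space \<Rightarrow>\<^sub>L 'a) set \<Rightarrow> ('a \<Rightarrow>\<^sub>L 'a) \<Rightarrow> bool"
  where "greatest_element X G \<longleftrightarrow> G \<in> X \<and> (\<forall>L\<in>X. L \<le>\<^sub>L G)"

end

theory Submission
  imports Defs
begin

text \<open>
  The greatest commuting lower bound is an infimum inside the bicommutant of \<open>M\<close>. Let \<open>\<L>\<close> be the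
  set of commuting lower bounds and \<open>\<D>\<close> the set of those symmetric operators in the bicommutant
  that lie above all of \<open>\<L>\<close>. As \<open>M\<close> is commutative, it is contained in its own commutant, so the
  members of \<open>\<D>\<close> commute with \<open>M\<close>, with each other and with all of \<open>\<L>\<close>; also \<open>M \<subseteq> \<D>\<close>.

  Two commuting symmetric operators have the minimum \<open>min A B = (A + B - \<bar>A - B\<bar>) / 2\<close>, which lies
  above every lower bound that commutes with both (\<open>commuting_min_exists\<close>), even though
  two members of \<open>\<L>\<close> may fail to commute. Hence \<open>\<D>\<close> is directed downwards. It is bounded below, because
  a multiple \<open>- norm L0\<close> of the identity lies below any lower bound \<open>L0\<close> of \<open>M\<close> and commutes with
  everything. A downward directed set that is bounded below converges strongly to its infimum
  (\<open>directed_infimum_exists\<close>), and this infimum \<open>G\<close> is the desired element: \<open>G\<close> lies below \<open>M\<close> as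
  \<open>M \<subseteq> \<D>\<close>, it lies above \<open>\<L>\<close> as every member of \<open>\<D>\<close> does, and strong limits of operators in the
  bicommutant stay there.

  The spectral theorem is avoided. The absolute value \<open>\<bar>C\<bar>\<close> is the square root of \<open>C\<^sup>2\<close>, a norm limit
  of polynomials in \<open>C\<^sup>2\<close> (\<open>symmetric_abs_exists\<close>). The order properties of the minimum, which
  usually come from spectral projections, follow by splitting the space into the closure of the
  range and the kernel of a symmetric operator (\<open>positive_if_positive_on_range_and_kernel\<close>).

  All this takes place in a real Hilbert space, with the real part of the inner product. Complex
  linearity is a commutation property: scalar multiplications are bounded real-linear operators
  in the commutant of \<open>M\<close>, hence \<open>G\<close> commutes with them.
\<close>

section \<open>Symmetric operators and their order\<close>

definition symmetric_op :: "('a::real_inner \<Rightarrow>\<^sub>L 'a) \<Rightarrow> bool"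
  where "symmetric_op T \<longleftrightarrow> (\<forall>u v. inner (T u) v = inner u (T v))"

definition form_le :: "('a::real_inner \<Rightarrow>\<^sub>L 'a) \<Rightarrow> ('a \<Rightarrow>\<^sub>L 'a) \<Rightarrow> bool"  (infix \<open>\<preceq>\<close> 50)
  where "S \<preceq> T \<longleftrightarrow> (\<forall>u. inner (S u) u \<le> inner (T u) u)"

lemma symmetric_opD: "symmetric_op T \<Longrightarrow> inner (T u) v = inner u (T v)"
  by (simp add: symmetric_op_def)

lemma symmetric_op_linear [intro]:
  "symmetric_op id_blinfun"
  "symmetric_op S \<Longrightarrow> symmetric_op T \<Longrightarrow> symmetric_op (S + T)"
  "symmetric_op S \<Longrightarrow> symmetric_op T \<Longrightarrow> symmetric_op (S - T)"
  "symmetric_op T \<Longrightarrow> symmetric_op (r *\<^sub>R T)"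
  by (simp_all add: symmetric_op_def blinfun.bilinear_simps inner_add_left inner_add_right
      inner_diff_left inner_diff_right)

lemma symmetric_op_square [intro]: "symmetric_op T \<Longrightarrow> symmetric_op (T o\<^sub>L T)"
  by (simp add: symmetric_op_def)

lemma commute_iff_pointwise: "A o\<^sub>L B = B o\<^sub>L A \<longleftrightarrow> (\<forall>x. A (B x) = B (A x))"
  by (auto intro: blinfun_eqI dest: arg_cong[where f = blinfun_apply] simp: fun_eq_iff)

lemma norm_blinfun_contraction: "norm (T :: _ \<Rightarrow>\<^sub>L _) \<le> 1 \<Longrightarrow> norm (T x) \<le> norm x"
  by (meson mult_left_le_one_le norm_blinfun norm_ge_zero order_trans)

section \<open>The absolute value of a symmetric operator\<close>

text \<open>
  With \<open>X = 1 - A\<close>, the equation \<open>2 Y = X + Y\<^sup>2\<close> says \<open>(1 - Y)\<^sup>2 = A\<close>, so \<open>1 - Y\<close> is a square root of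
  \<open>A\<close>. The iteration \<open>Y \<mapsto> (X + Y\<^sup>2) / 2\<close> from \<open>0\<close> converges in norm because it is dominated by the
  scalar iteration \<open>t \<mapsto> (1 + t\<^sup>2) / 2\<close>, which increases and is bounded by \<open>1\<close>: norms and increments
  of the operators are at most those of the numbers. The last clause records that the solution is
  a limit of polynomials in \<open>X\<close>; it transfers symmetry and commutation relations to \<open>Y\<close>.
\<close>

lemma quadratic_fixpoint_exists:
  fixes X :: "'a::banach \<Rightarrow>\<^sub>L 'a"
  assumes "norm X \<le> 1"
  obtains Y where "norm Y \<le> 1" "2 *\<^sub>R Y = X + (Y o\<^sub>L Y)"
    "\<And>\<S>. closed \<S> \<Longrightarrow> 0 \<in> \<S> \<Longrightarrow> (\<And>Z. Z \<in> \<S> \<Longrightarrow> (1/2) *\<^sub>R (X + (Z o\<^sub>L Z)) \<in> \<S>) \<Longrightarrow> Y \<in> \<S>"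
proof -
  define step where "step Z = (1/2) *\<^sub>R (X + (Z o\<^sub>L Z))" for Z
  define Y where "Y n = (step ^^ n) 0" for n
  define y :: "nat \<Rightarrow> real" where "y n = ((\<lambda>t. (1 + t\<^sup>2) / 2) ^^ n) 0" for n
  have Y_simps: "Y 0 = 0" "Y (Suc n) = (1/2) *\<^sub>R (X + (Y n o\<^sub>L Y n))" for n
    by (simp_all add: Y_def step_def)
  have y_simps: "y 0 = 0" "y (Suc n) = (1 + (y n)\<^sup>2) / 2" for n
    by (simp_all add: y_def)
  have y_bounds: "0 \<le> y n \<and> y n \<le> 1" for n
    by (induction n) (auto simp: y_simps power_le_one)
  have norm_Y: "norm (Y n) \<le> y n" for n
  proof (induction n)
    case (Suc n)
    have "norm (Y n o\<^sub>L Y n) \<le> (y n)\<^sup>2"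
      using norm_blinfun_compose[of "Y n" "Y n"] mult_mono[OF Suc Suc] y_bounds[of n]
      by (simp add: power2_eq_square)
    then have "norm (X + (Y n o\<^sub>L Y n)) \<le> 1 + (y n)\<^sup>2"
      using assms norm_triangle_ineq[of X "Y n o\<^sub>L Y n"] by linarith
    then show ?case
      by (simp add: Y_simps y_simps)
  qed (simp add: Y_simps y_simps)
  have step_Y: "norm (Y (Suc n) - Y n) \<le> y (Suc n) - y n" for n
  proof (induction n)
    case 0
    then show ?case
      using assms by (simp add: Y_simps y_simps)
  next
    case (Suc n)
    let ?D = "Y (Suc n) - Y n"
    \<comment> \<open>The identity \<open>U\<^sup>2 - V\<^sup>2 = U (U - V) + (U - V) V\<close> for possibly noncommuting \<open>U\<close> and \<open>V\<close>.\<close>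
    have "Y (Suc (Suc n)) - Y (Suc n) = (1/2) *\<^sub>R ((Y (Suc n) o\<^sub>L ?D) + (?D o\<^sub>L Y n))"
      by (subst (1 2) Y_simps(2))
        (auto intro!: blinfun_eqI simp: blinfun.bilinear_simps algebra_simps)
    moreover have "norm (Y (Suc n) o\<^sub>L ?D) \<le> y (Suc n) * (y (Suc n) - y n)"
      using norm_blinfun_compose[of "Y (Suc n)" ?D] mult_mono[OF norm_Y[of "Suc n"] Suc]
        y_bounds[of "Suc n"] by (simp add: order_trans)
    moreover have "norm (?D o\<^sub>L Y n) \<le> (y (Suc n) - y n) * y n"
      using norm_blinfun_compose[of ?D "Y n"] mult_mono[OF Suc norm_Y[of n]] Suc
        norm_ge_zero[of ?D] by (smt (verit) norm_ge_zero)
    ultimately have "norm (Y (Suc (Suc n)) - Y (Suc n))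
        \<le> (y (Suc n) * (y (Suc n) - y n) + (y (Suc n) - y n) * y n) / 2"
      using norm_triangle_ineq[of "Y (Suc n) o\<^sub>L ?D" "?D o\<^sub>L Y n"] by simp
    also have "\<dots> = ((y (Suc n))\<^sup>2 - (y n)\<^sup>2) / 2"
      by (simp add: power2_eq_square algebra_simps)
    also have "\<dots> = y (Suc (Suc n)) - y (Suc n)"
      using y_simps(2)[of "Suc n"] y_simps(2)[of n] by (simp add: diff_divide_distrib add_divide_distrib)
    finally show ?case .
  qed
  have dist_Y: "norm (Y (m + k) - Y m) \<le> y (m + k) - y m" for m k
  proof (induction k)
    case (Suc k)
    then show ?case
      using norm_triangle_ineq[of "Y (Suc (m + k)) - Y (m + k)" "Y (m + k) - Y m"] step_Y[of "m + k"]
      by simp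
  qed simp
  have "incseq y"
    by (intro incseq_SucI) (smt (verit) step_Y norm_ge_zero)
  then have "convergent y"
    using y_bounds incseq_convergent[of y 1] by (metis convergentI)
  then have "Cauchy y"
    by (rule convergent_Cauchy)
  have "Cauchy Y"
  proof (rule metric_CauchyI)
    fix e :: real assume "e > 0"
    with \<open>Cauchy y\<close> obtain N where N: "\<And>n. n \<ge> N \<Longrightarrow> dist (y n) (y N) < e / 2"
      by (metis metric_CauchyD half_gt_zero order_refl)
    have "dist (Y n) (Y N) < e / 2" if "n \<ge> N" for n
      using N[OF that] dist_Y[of N "n - N"] abs_ge_self[of "y n - y N"] that
      by (simp add: dist_norm)
    then show "\<exists>N. \<forall>m\<ge>N. \<forall>n\<ge>N. dist (Y m) (Y n) < e"
      by (meson dist_triangle_half_l dist_commute)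
  qed
  then obtain L where L: "Y \<longlonglongrightarrow> L"
    using Cauchy_convergent convergent_def by blast
  have "norm L \<le> 1"
    by (rule LIMSEQ_le_const2[OF tendsto_norm[OF L]]) (meson norm_Y y_bounds order_trans)
  moreover have "2 *\<^sub>R L = X + (L o\<^sub>L L)"
  proof -
    have "(\<lambda>n. Y (Suc n)) \<longlonglongrightarrow> (1/2) *\<^sub>R (X + (L o\<^sub>L L))"
      unfolding Y_simps by (intro tendsto_intros bounded_bilinear.tendsto[OF bounded_bilinear_blinfun_compose] L)
    then have "L = (1/2) *\<^sub>R (X + (L o\<^sub>L L))"
      using LIMSEQ_unique[OF LIMSEQ_Suc[OF L]] by blast
    then show ?thesis
      by (metis (no_types, opaque_lifting) add.commute scaleR_half_double scaleR_right_distrib scaleR_2)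
  qed
  moreover have "L \<in> \<S>"
    if "closed \<S>" "0 \<in> \<S>" "\<And>Z. Z \<in> \<S> \<Longrightarrow> (1/2) *\<^sub>R (X + (Z o\<^sub>L Z)) \<in> \<S>" for \<S>
  proof -
    have "Y n \<in> \<S>" for n
      by (induction n) (auto simp: Y_simps that)
    then show ?thesis
      using closed_sequentially[OF that(1) _ L] by blast
  qed
  ultimately show thesis
    by (rule that)
qed

text \<open>
  The square root of \<open>A = C\<^sup>2\<close> is \<open>1 - Y\<close> for the solution \<open>Y\<close> above. That \<open>1 - C\<^sup>2\<close> is a contraction
  is the expansion of \<open>(norm (u - C (C u)))\<^sup>2\<close>, and \<open>1 - Y\<close> is positive since \<open>norm Y \<le> 1\<close>.
\<close>

lemma symmetric_abs_exists_contraction: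
  fixes C :: "'a::{real_inner,banach} \<Rightarrow>\<^sub>L 'a"
  assumes sym: "symmetric_op C" and "norm C \<le> 1"
  obtains R where "symmetric_op R" "0 \<preceq> R" "R o\<^sub>L R = C o\<^sub>L C"
    "\<And>Z. C o\<^sub>L Z = Z o\<^sub>L C \<Longrightarrow> R o\<^sub>L Z = Z o\<^sub>L R"
proof -
  define X where "X = id_blinfun - (C o\<^sub>L C)"
  have "norm (X u) \<le> norm u" for u
  proof -
    have "(norm (X u))\<^sup>2 = (norm u)\<^sup>2 - 2 * (norm (C u))\<^sup>2 + (norm (C (C u)))\<^sup>2"
      using symmetric_opD[OF sym, of "C u" u]
      by (simp add: X_def blinfun.bilinear_simps power2_norm_eq_inner inner_diff_left
          inner_diff_right inner_commute)
    also have "\<dots> \<le> (norm u)\<^sup>2"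
      using power_mono[OF norm_blinfun_contraction[OF assms(2), of "C u"], of 2]
      by (smt (verit) norm_ge_zero zero_le_power2)
    finally show ?thesis
      by (simp add: power2_le_iff_abs_le)
  qed
  then have "norm X \<le> 1"
    by (intro norm_blinfun_bound) auto
  then obtain Y where Y: "norm Y \<le> 1" "2 *\<^sub>R Y = X + (Y o\<^sub>L Y)"
    and closed_in: "\<And>\<S>. closed \<S> \<Longrightarrow> 0 \<in> \<S> \<Longrightarrow>
      (\<And>Z. Z \<in> \<S> \<Longrightarrow> (1/2) *\<^sub>R (X + (Z o\<^sub>L Z)) \<in> \<S>) \<Longrightarrow> Y \<in> \<S>"
    using quadratic_fixpoint_exists by blast
  have "symmetric_op X"
    unfolding X_def using sym by blast
  have "Y \<in> {Z. symmetric_op Z}"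
  proof (rule closed_in)
    show "closed {Z :: 'a \<Rightarrow>\<^sub>L 'a. symmetric_op Z}"
      unfolding symmetric_op_def
      by (intro closed_Collect_all closed_Collect_eq continuous_intros)
  qed (use \<open>symmetric_op X\<close> in \<open>auto simp: symmetric_op_def[of 0]\<close>)
  moreover have "Y o\<^sub>L Z = Z o\<^sub>L Y" if "C o\<^sub>L Z = Z o\<^sub>L C" for Z
  proof -
    have "Y \<in> {Y. Y o\<^sub>L Z = Z o\<^sub>L Y}"
    proof (rule closed_in)
      show "closed {Y. Y o\<^sub>L Z = Z o\<^sub>L Y}"
        by (intro closed_Collect_eq continuous_intros
            bounded_bilinear.continuous_on[OF bounded_bilinear_blinfun_compose])
    qed (use that in \<open>auto simp: commute_iff_pointwise X_def blinfun.bilinear_simps\<close>)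
    then show ?thesis by simp
  qed
  moreover have "0 \<preceq> id_blinfun - Y"
  proof -
    have "inner (Y u) u \<le> inner u u" for u
    proof -
      have "inner (Y u) u \<le> norm (Y u) * norm u"
        by (rule norm_cauchy_schwarz)
      also have "\<dots> \<le> norm u * norm u"
        by (intro mult_right_mono norm_blinfun_contraction[OF Y(1)]) simp
      finally show ?thesis
        by (simp add: norm_eq_sqrt_inner)
    qed
    then show ?thesis
      by (simp add: form_le_def blinfun.bilinear_simps inner_diff_left)
  qed
  moreover have "(id_blinfun - Y) o\<^sub>L (id_blinfun - Y) = C o\<^sub>L C"
  proof (rule blinfun_eqI)
    fix u
    have "2 *\<^sub>R Y u = u - C (C u) + Y (Y u)"
      using arg_cong[OF Y(2), of "\<lambda>T. T u"] by (simp add: X_def blinfun.bilinear_simps)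
    then show "((id_blinfun - Y) o\<^sub>L (id_blinfun - Y)) u = (C o\<^sub>L C) u"
      by (simp add: blinfun.bilinear_simps scaleR_2 algebra_simps)
  qed
  ultimately show thesis
    by (intro that[of "id_blinfun - Y"])
      (auto simp: commute_iff_pointwise blinfun.bilinear_simps)
qed

lemma symmetric_abs_exists:
  fixes C :: "'a::{real_inner,banach} \<Rightarrow>\<^sub>L 'a"
  assumes "symmetric_op C"
  obtains R where "symmetric_op R" "0 \<preceq> R" "R o\<^sub>L R = C o\<^sub>L C"
    "\<And>Z. C o\<^sub>L Z = Z o\<^sub>L C \<Longrightarrow> R o\<^sub>L Z = Z o\<^sub>L R"
proof -
  define k where "k = norm C + 1"
  have "k > 0"
    by (simp add: k_def add_nonneg_pos)
  have "norm ((1/k) *\<^sub>R C) \<le> 1"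
    using \<open>k > 0\<close> by (simp add: k_def)
  moreover have "symmetric_op ((1/k) *\<^sub>R C)"
    using assms by blast
  ultimately obtain R where R: "symmetric_op R" "0 \<preceq> R"
      "R o\<^sub>L R = ((1/k) *\<^sub>R C) o\<^sub>L ((1/k) *\<^sub>R C)"
      "\<And>Z. ((1/k) *\<^sub>R C) o\<^sub>L Z = Z o\<^sub>L ((1/k) *\<^sub>R C) \<Longrightarrow> R o\<^sub>L Z = Z o\<^sub>L R"
    using symmetric_abs_exists_contraction by blast
  show thesis
  proof (rule that)
    show "symmetric_op (k *\<^sub>R R)"
      using R(1) by blast
    show "0 \<preceq> k *\<^sub>R R"
      using R(2) \<open>k > 0\<close> by (simp add: form_le_def blinfun.bilinear_simps)
    show "(k *\<^sub>R R) o\<^sub>L (k *\<^sub>R R) = C o\<^sub>L C"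
    proof (rule blinfun_eqI)
      fix u
      have "R (R u) = (1/k) *\<^sub>R (1/k) *\<^sub>R C (C u)"
        using arg_cong[OF R(3), of "\<lambda>T. T u"] by (simp add: blinfun.bilinear_simps)
      then show "((k *\<^sub>R R) o\<^sub>L (k *\<^sub>R R)) u = (C o\<^sub>L C) u"
        using \<open>k > 0\<close> by (simp add: blinfun.bilinear_simps)
    qed
    show "(k *\<^sub>R R) o\<^sub>L Z = Z o\<^sub>L (k *\<^sub>R R)" if "C o\<^sub>L Z = Z o\<^sub>L C" for Z
      using R(4)[of Z] that by (simp add: commute_iff_pointwise blinfun.bilinear_simps)
  qed
qed

section \<open>Positivity on a range and on a kernel\<close>

text \<open>
  The splitting of \<open>u\<close> into a kernel part and a part in the closure of the range, obtained without
  orthogonal projections: the kernel part is \<open>e = lim S\<^bsup>2n\<^esup> u\<close> with \<open>S = 1 - R\<^sup>2\<close>. The squared norms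
  \<open>q n\<close> of \<open>S\<^bsup>n\<^esup> u\<close> decrease, hence converge, and by symmetry of \<open>S\<close> the squared distance of two
  even iterates is a second difference of \<open>q\<close>, which gives the Cauchy property. The limit is fixed
  by \<open>S\<^sup>2\<close>, and \<open>S\<close> strictly shrinks every vector outside the kernel of \<open>R\<close>. Finally \<open>u - S\<^bsup>n\<^esup> u\<close> is
  in the range of \<open>R\<close> for each \<open>n\<close>.
\<close>

lemma range_kernel_decomposition_contraction:
  fixes R :: "'a::{real_inner,banach} \<Rightarrow>\<^sub>L 'a"
  assumes sym: "symmetric_op R" and "norm R \<le> 1"
  obtains w e where "R e = 0" "(\<lambda>n. R (w n)) \<longlonglongrightarrow> u - e"
proof -
  define S where "S = id_blinfun - (R o\<^sub>L R)"
  have S_apply: "S x = x - R (R x)" for x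
    by (simp add: S_def blinfun.bilinear_simps)
  have "symmetric_op S"
    unfolding S_def using sym by blast
  have norm_S: "(norm (S x))\<^sup>2 \<le> (norm x)\<^sup>2 - (norm (R x))\<^sup>2" for x
  proof -
    have "(norm (S x))\<^sup>2 = (norm x)\<^sup>2 - 2 * (norm (R x))\<^sup>2 + (norm (R (R x)))\<^sup>2"
      using symmetric_opD[OF sym, of "R x" x]
      by (simp add: S_apply power2_norm_eq_inner inner_diff_left inner_diff_right inner_commute)
    then show ?thesis
      using power_mono[OF norm_blinfun_contraction[OF assms(2), of "R x"], of 2] by simp
  qed
  define s where "s n = (blinfun_apply S ^^ n) u" for n
  have s_Suc: "s (Suc n) = S (s n)" for n
    by (simp add: s_def)
  have s_inner: "inner (s (n + i)) (s m) = inner (s n) (s (m + i))" for i n m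
  proof (induction i arbitrary: m)
    case (Suc i)
    have "inner (s (n + Suc i)) (s m) = inner (s (n + i)) (s (Suc m))"
      by (simp add: s_Suc symmetric_opD[OF \<open>symmetric_op S\<close>])
    then show ?case
      by (simp add: Suc)
  qed simp
  define q where "q n = (norm (s n))\<^sup>2" for n
  have "q (Suc n) \<le> q n" for n
    using norm_S[of "s n"] zero_le_power2[of "norm (R (s n))"] unfolding q_def s_Suc by linarith
  then have "decseq q"
    by (rule decseq_SucI)
  then have "Cauchy q"
    by (metis convergent_Cauchy convergentI decseq_convergent q_def zero_le_power2)
  \<comment> \<open>Only even exponents: the mixed inner product then has an even exponent sum, so it is a value of \<open>q\<close>.\<close>
  have s_diff: "(norm (s (2 * n) - s (2 * m)))\<^sup>2 = q (2 * n) - 2 * q (n + m) + q (2 * m)" for n m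
  proof -
    have "inner (s (2 * n)) (s (2 * m)) = q (n + m)"
    proof (cases "m \<le> n")
      case True
      then show ?thesis
        using s_inner[of "n + m" "n - m" "2 * m"] by (simp add: q_def power2_norm_eq_inner mult_2 add.commute[of m n])
    next
      case False
      then show ?thesis
        using s_inner[of "2 * n" "m - n" "n + m"] by (simp add: q_def power2_norm_eq_inner mult_2 add.commute[of m n])
    qed
    then show ?thesis
      by (simp add: q_def power2_norm_eq_inner inner_diff_left inner_diff_right inner_commute)
  qed
  have "Cauchy (\<lambda>n. s (2 * n))"
  proof (rule metric_CauchyI)
    fix e :: real assume "e > 0"
    then have "e\<^sup>2 / 2 > 0" by simp
    with \<open>Cauchy q\<close> obtain N where N: "\<And>m n. m \<ge> N \<Longrightarrow> n \<ge> N \<Longrightarrow> dist (q m) (q n) < e\<^sup>2 / 2"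
      by (meson metric_CauchyD)
    have "dist (s (2 * m)) (s (2 * n)) < e" if "m \<ge> N" "n \<ge> N" for m n
    proof -
      have "(norm (s (2 * m) - s (2 * n)))\<^sup>2 < e\<^sup>2"
        using N[of "2 * m" "m + n"] N[of "2 * n" "m + n"] that
        unfolding s_diff dist_real_def by (simp add: abs_if split: if_splits)
      then show ?thesis
        using \<open>e > 0\<close> by (simp add: dist_norm power_less_imp_less_base)
    qed
    then show "\<exists>N. \<forall>m\<ge>N. \<forall>n\<ge>N. dist (s (2 * m)) (s (2 * n)) < e"
      by blast
  qed
  then obtain e where e: "(\<lambda>n. s (2 * n)) \<longlonglongrightarrow> e"
    using Cauchy_convergent convergent_def by blast
  have "S (S e) = e"
  proof (rule LIMSEQ_unique)
    show "(\<lambda>n. s (2 * Suc n)) \<longlonglongrightarrow> e"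
      using LIMSEQ_Suc[OF e] .
    show "(\<lambda>n. s (2 * Suc n)) \<longlonglongrightarrow> S (S e)"
      by (simp add: s_Suc) (intro tendsto_intros e)
  qed
  then have "R e = 0"
    using norm_S[of e] norm_S[of "S e"] by (smt (verit) norm_eq_zero zero_eq_power2 zero_le_power2)
  have "\<exists>w. u - s n = R w" for n
  proof (induction n)
    case 0
    then show ?case by (metis blinfun.zero_right diff_self funpow_0 s_def)
  next
    case (Suc n)
    then obtain w where "u - s n = R w" by blast
    then have "u - s (Suc n) = R (w + R (s n))"
      by (simp add: s_Suc S_apply blinfun.bilinear_simps algebra_simps)
    then show ?case by blast
  qed
  then obtain w where w: "\<And>n. u - s n = R (w n)" by metis
  have "(\<lambda>n. R (w (2 * n))) \<longlonglongrightarrow> u - e"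
    unfolding w[symmetric] by (intro tendsto_intros e)
  with \<open>R e = 0\<close> show thesis
    by (rule that)
qed

lemma range_kernel_decomposition:
  fixes R :: "'a::{real_inner,banach} \<Rightarrow>\<^sub>L 'a"
  assumes "symmetric_op R"
  obtains w e where "R e = 0" "(\<lambda>n. R (w n)) \<longlonglongrightarrow> u - e"
proof -
  define k where "k = norm R + 1"
  have "k > 0"
    by (simp add: k_def add_nonneg_pos)
  have "norm ((1/k) *\<^sub>R R) \<le> 1"
    using \<open>k > 0\<close> by (simp add: k_def)
  moreover have "symmetric_op ((1/k) *\<^sub>R R)"
    using assms by blast
  ultimately obtain w e where
      "((1/k) *\<^sub>R R) e = 0" "(\<lambda>n. ((1/k) *\<^sub>R R) (w n)) \<longlonglongrightarrow> u - e"
    using range_kernel_decomposition_contraction by blast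
  then have "R e = 0" "(\<lambda>n. R ((1/k) *\<^sub>R w n)) \<longlonglongrightarrow> u - e"
    using \<open>k > 0\<close> by (simp_all add: blinfun.bilinear_simps)
  then show thesis
    by (rule that)
qed

text \<open>
  Since \<open>T\<close> commutes with \<open>R\<close>, it maps the range of \<open>R\<close> into itself, so the range part and the kernel
  part of a vector contribute no mixed term to the quadratic form of \<open>T\<close>.
\<close>

lemma positive_if_positive_on_range_and_kernel:
  fixes R T :: "'a::{real_inner,banach} \<Rightarrow>\<^sub>L 'a"
  assumes R: "symmetric_op R" and T: "symmetric_op T" and comm: "T o\<^sub>L R = R o\<^sub>L T"
    and range: "\<And>v. 0 \<le> inner (T (R v)) (R v)"
    and kernel: "\<And>e. R e = 0 \<Longrightarrow> 0 \<le> inner (T e) e"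
  shows "0 \<preceq> T"
proof -
  have "0 \<le> inner (T u) u" for u
  proof -
    obtain w e where e: "R e = 0" and w: "(\<lambda>n. R (w n)) \<longlonglongrightarrow> u - e"
      using range_kernel_decomposition[OF R] by blast
    have "0 \<le> inner (T (u - e)) (u - e)"
      by (rule LIMSEQ_le_const[of "\<lambda>n. inner (T (R (w n))) (R (w n))"])
        (intro tendsto_intros w, use range in blast)
    moreover have "inner (T (u - e)) e = 0"
    proof (rule LIMSEQ_unique)
      show "(\<lambda>n. inner (T (R (w n))) e) \<longlonglongrightarrow> inner (T (u - e)) e"
        by (intro tendsto_intros w)
      have "inner (T (R (w n))) e = 0" for n
        using comm e by (simp add: commute_iff_pointwise symmetric_opD[OF R])
      then show "(\<lambda>n. inner (T (R (w n))) e) \<longlonglongrightarrow> 0"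
        by simp
    qed
    moreover have "inner (T u) u
        = inner (T (u - e)) (u - e) + 2 * inner (T (u - e)) e + inner (T e) e"
      using symmetric_opD[OF T, of u e]
      by (simp add: blinfun.bilinear_simps inner_diff_left inner_diff_right inner_commute)
    ultimately show ?thesis
      using kernel[OF e] by simp
  qed
  then show ?thesis
    by (simp add: form_le_def)
qed

section \<open>The minimum of two commuting operators\<close>

text \<open>
  Operators with \<open>Q P = 0\<close> play the role of the positive and negative part of \<open>P - Q\<close>. On the range
  of \<open>P\<close> the operators \<open>P\<close> and \<open>P + Q\<close> agree, and on the kernel of \<open>P\<close> there is nothing to show.
\<close>

lemma positive_if_disjoint_sum_positive:
  fixes P Q :: "'a::{real_inner,banach} \<Rightarrow>\<^sub>L 'a"
  assumes P: "symmetric_op P" and "Q o\<^sub>L P = 0" and sum: "0 \<preceq> P + Q"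
  shows "0 \<preceq> P"
proof (rule positive_if_positive_on_range_and_kernel[OF P P refl])
  fix v
  have "Q (P v) = 0"
    using arg_cong[OF assms(2), of "\<lambda>T. T v"] by simp
  moreover have "0 \<le> inner ((P + Q) (P v)) (P v)"
    using sum by (simp add: form_le_def)
  ultimately show "0 \<le> inner (P (P v)) (P v)"
    by (simp add: blinfun.bilinear_simps)
qed simp

text \<open>
  Let \<open>P\<close> and \<open>Q\<close> be the positive and negative part \<open>(\<bar>A - B\<bar> \<plusminus> (A - B)) / 2\<close> of \<open>A - B\<close>; then
  \<open>P Q = 0\<close> and \<open>W = A - P = B - Q\<close>. On the range of \<open>P\<close> the operator \<open>W\<close> agrees with \<open>B\<close>, and on
  the kernel of \<open>P\<close> it agrees with \<open>A\<close>; so \<open>W - L\<close> is positive on both for every lower bound \<open>L\<close>.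
  The mixed terms vanish if \<open>L\<close> commutes with \<open>A\<close> and \<open>B\<close>, because \<open>P\<close> then commutes with \<open>W - L\<close>.
\<close>

lemma commuting_min_exists:
  fixes A B :: "'a::{real_inner,banach} \<Rightarrow>\<^sub>L 'a"
  assumes A: "symmetric_op A" and B: "symmetric_op B" and AB: "A o\<^sub>L B = B o\<^sub>L A"
  obtains W where "symmetric_op W" "W \<preceq> A" "W \<preceq> B"
    "\<And>Z. A o\<^sub>L Z = Z o\<^sub>L A \<Longrightarrow> B o\<^sub>L Z = Z o\<^sub>L B \<Longrightarrow> W o\<^sub>L Z = Z o\<^sub>L W"
    "\<And>L. symmetric_op L \<Longrightarrow> A o\<^sub>L L = L o\<^sub>L A \<Longrightarrow> B o\<^sub>L L = L o\<^sub>L B \<Longrightarrow> L \<preceq> A \<Longrightarrow> L \<preceq> B \<Longrightarrow> L \<preceq> W"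
proof -
  obtain R where R: "symmetric_op R" "0 \<preceq> R" "R o\<^sub>L R = (A - B) o\<^sub>L (A - B)"
    and R_comm: "\<And>Z. (A - B) o\<^sub>L Z = Z o\<^sub>L (A - B) \<Longrightarrow> R o\<^sub>L Z = Z o\<^sub>L R"
    using symmetric_abs_exists[of "A - B"] A B by blast
  define P where "P = (1/2) *\<^sub>R (R + (A - B))"
  define Q where "Q = (1/2) *\<^sub>R (R - (A - B))"
  have sym: "symmetric_op P" "symmetric_op Q"
    unfolding P_def Q_def using A B R(1) by blast+
  have RR: "R (R x) = A (A x) - A (B x) - B (A x) + B (B x)" for x
    using arg_cong[OF R(3), of "\<lambda>T. T x"] by (simp add: blinfun.bilinear_simps)
  have RC: "R (A x) - R (B x) = A (R x) - B (R x)" for x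
    using R_comm[of "A - B"] by (simp add: commute_iff_pointwise blinfun.bilinear_simps)
  have "(R - (A - B)) ((R + (A - B)) x) = 0" "(R + (A - B)) ((R - (A - B)) x) = 0" for x
    using RC[of x] by (simp_all add: blinfun.bilinear_simps RR algebra_simps)
  then have QP: "Q o\<^sub>L P = 0" and PQ: "P o\<^sub>L Q = 0"
    by (auto intro!: blinfun_eqI simp: P_def Q_def blinfun.scaleR_left blinfun.scaleR_right)
  have "P + Q = R"
    by (simp add: P_def Q_def scaleR_add_right[symmetric] flip: scaleR_2)
  then have pos: "0 \<preceq> P" "0 \<preceq> Q"
    using positive_if_disjoint_sum_positive[OF sym(1) QP] positive_if_disjoint_sum_positive[OF sym(2) PQ]
      R(2) by (simp_all add: add.commute)
  have W_B: "A - P = B - Q"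
  proof -
    have "P - Q = (1/2) *\<^sub>R ((A - B) + (A - B))"
      unfolding P_def Q_def scaleR_diff_right[symmetric] by (simp add: algebra_simps)
    also have "\<dots> = A - B"
      by (rule scaleR_half_double)
    finally show ?thesis
      by (simp add: algebra_simps)
  qed
  have P_comm: "P o\<^sub>L Z = Z o\<^sub>L P" if "A o\<^sub>L Z = Z o\<^sub>L A" "B o\<^sub>L Z = Z o\<^sub>L B" for Z
    using R_comm[of Z] that by (simp add: P_def commute_iff_pointwise blinfun.bilinear_simps)
  show thesis
  proof (rule that)
    show "symmetric_op (A - P)"
      using A sym by blast
    show "A - P \<preceq> A"
      using pos(1) by (simp add: form_le_def blinfun.bilinear_simps inner_diff_left)
    show "A - P \<preceq> B"
      unfolding W_B using pos(2) by (simp add: form_le_def blinfun.bilinear_simps inner_diff_left)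
    show "(A - P) o\<^sub>L Z = Z o\<^sub>L (A - P)" if "A o\<^sub>L Z = Z o\<^sub>L A" "B o\<^sub>L Z = Z o\<^sub>L B" for Z
      using P_comm[OF that] that by (simp add: commute_iff_pointwise blinfun.bilinear_simps)
    show "L \<preceq> A - P"
      if L: "symmetric_op L" "A o\<^sub>L L = L o\<^sub>L A" "B o\<^sub>L L = L o\<^sub>L B" "L \<preceq> A" "L \<preceq> B" for L
    proof -
      have "0 \<preceq> A - P - L"
      proof (rule positive_if_positive_on_range_and_kernel[OF sym(1)])
        show "symmetric_op (A - P - L)"
          using A sym L by blast
        show "(A - P - L) o\<^sub>L P = P o\<^sub>L (A - P - L)"
          using P_comm[OF L(2,3)] P_comm[OF refl] AB
          by (simp add: commute_iff_pointwise blinfun.bilinear_simps)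
        show "0 \<le> inner ((A - P - L) (P v)) (P v)" for v
        proof -
          have "Q (P v) = 0"
            using arg_cong[OF QP, of "\<lambda>T. T v"] by simp
          then show ?thesis
            unfolding W_B using L(5) by (simp add: form_le_def blinfun.bilinear_simps inner_diff_left)
        qed
        show "0 \<le> inner ((A - P - L) e) e" if "P e = 0" for e
          using that L(4) by (simp add: form_le_def blinfun.bilinear_simps inner_diff_left)
      qed
      then show ?thesis
        by (simp add: form_le_def blinfun.bilinear_simps inner_diff_left)
    qed
  qed
qed

section \<open>Infima of downward directed sets\<close>

text \<open>
  A consequence of the Cauchy-Schwarz inequality for the positive form of \<open>T\<close>, read off from
  positivity at the single vector \<open>k u - T u\<close>. It turns convergence of quadratic forms into strong
  convergence of operators.
\<close>

lemma positive_norm_square_le_form: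
  fixes T :: "'a::real_inner \<Rightarrow>\<^sub>L 'a"
  assumes T: "symmetric_op T" "0 \<preceq> T" and k: "0 < k" "\<And>v. inner (T v) v \<le> k * (norm v)\<^sup>2"
  shows "(norm (T u))\<^sup>2 \<le> k * inner (T u) u"
proof -
  let ?n = "(norm (T u))\<^sup>2"
  have "0 \<le> inner (T (k *\<^sub>R u - T u)) (k *\<^sub>R u - T u)"
    using T(2) by (simp add: form_le_def)
  also have "\<dots> = k\<^sup>2 * inner (T u) u - 2 * k * ?n + inner (T (T u)) (T u)"
    using symmetric_opD[OF T(1), of "T u" u]
    by (simp add: blinfun.bilinear_simps inner_diff_left inner_diff_right power2_norm_eq_inner
        power2_eq_square[of k] algebra_simps)
  also have "\<dots> \<le> k\<^sup>2 * inner (T u) u - k * ?n"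
    using k(2)[of "T u"] by simp
  also have "\<dots> = k * (k * inner (T u) u - ?n)"
    by (simp add: power2_eq_square algebra_simps)
  finally show ?thesis
    using k(1) by (simp add: zero_le_mult_iff)
qed

text \<open>
  At each vector \<open>u\<close> the values \<open>inner (T u) u\<close> decrease to their infimum along \<open>\<D>\<close>. Below a fixed
  \<open>d0\<close> the differences of comparable members have forms bounded by a common constant \<open>k\<close>, so the
  previous inequality makes \<open>T u\<close> a Cauchy net. Its limit is linear and bounded in \<open>u\<close>, and all the
  claims about it are closed under pointwise limits.
\<close>

lemma directed_infimum_exists:
  fixes \<D> :: "('a::{real_inner,banach} \<Rightarrow>\<^sub>L 'a) set"
  assumes ne: "\<D> \<noteq> {}" and sym: "\<And>T. T \<in> \<D> \<Longrightarrow> symmetric_op T"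
    and directed: "\<And>S T. S \<in> \<D> \<Longrightarrow> T \<in> \<D> \<Longrightarrow> \<exists>W\<in>\<D>. W \<preceq> S \<and> W \<preceq> T"
    and bound: "\<And>T. T \<in> \<D> \<Longrightarrow> c *\<^sub>R id_blinfun \<preceq> T"
  obtains G where "symmetric_op G" "\<And>T. T \<in> \<D> \<Longrightarrow> G \<preceq> T"
    "\<And>L. (\<And>T. T \<in> \<D> \<Longrightarrow> L \<preceq> T) \<Longrightarrow> L \<preceq> G"
    "\<And>Z. (\<And>T. T \<in> \<D> \<Longrightarrow> T o\<^sub>L Z = Z o\<^sub>L T) \<Longrightarrow> G o\<^sub>L Z = Z o\<^sub>L G"
proof -
  \<comment> \<open>The filter of tails of the directed set; limits along it are limits of the net \<open>\<D>\<close>.\<close>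
  define F where "F = (INF d\<in>\<D>. principal {x \<in> \<D>. x \<preceq> d})"
  have le_trans: "S \<preceq> U" if "S \<preceq> T" "T \<preceq> U" for S T U :: "'a \<Rightarrow>\<^sub>L 'a"
    using that by (meson form_le_def order_trans)
  have le_refl: "T \<preceq> T" for T :: "'a \<Rightarrow>\<^sub>L 'a"
    by (simp add: form_le_def)
  have ev_F: "eventually Pr F \<longleftrightarrow> (\<exists>d\<in>\<D>. \<forall>x\<in>\<D>. x \<preceq> d \<longrightarrow> Pr x)" for Pr
  proof -
    have "\<exists>x\<in>\<D>. principal {y \<in> \<D>. y \<preceq> x} \<le> inf (principal {y \<in> \<D>. y \<preceq> a}) (principal {y \<in> \<D>. y \<preceq> b})"
      if "a \<in> \<D>" "b \<in> \<D>" for a b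
      using directed[OF that] le_trans by auto
    then show ?thesis
      unfolding F_def by (subst eventually_INF_base[OF ne]) (auto simp: eventually_principal)
  qed
  have "F \<noteq> bot"
    unfolding trivial_limit_def ev_F using le_refl by auto
  have ev_below: "\<forall>\<^sub>F x in F. x \<in> \<D> \<and> x \<preceq> d" if "d \<in> \<D>" for d
    unfolding ev_F using that by blast
  have ev_in: "\<forall>\<^sub>F x in F. x \<in> \<D>"
    unfolding ev_F using ne by blast
  obtain d0 where d0: "d0 \<in> \<D>"
    using ne by blast
  define k where "k = norm d0 + \<bar>c\<bar> + 1"
  have "k > 0"
    by (simp add: k_def add_nonneg_pos)
  have form_gap: "inner (d v) v - inner (x v) v \<le> k * (norm v)\<^sup>2"
    if "d \<preceq> d0" "x \<in> \<D>" for d x v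
  proof -
    have "inner (d v) v \<le> inner (d0 v) v"
      using that(1) by (simp add: form_le_def)
    also have "\<dots> \<le> norm d0 * norm v * norm v"
      by (meson norm_blinfun norm_cauchy_schwarz norm_ge_zero mult_right_mono order_trans)
    finally have "inner (d v) v \<le> norm d0 * (norm v)\<^sup>2"
      by (simp add: power2_eq_square mult.assoc)
    moreover have "c * (norm v)\<^sup>2 \<le> inner (x v) v"
      using bound[OF that(2)] by (simp add: form_le_def blinfun.bilinear_simps power2_norm_eq_inner)
    moreover have "(norm d0 - c) * (norm v)\<^sup>2 \<le> k * (norm v)\<^sup>2"
      by (rule mult_right_mono) (auto simp: k_def)
    ultimately show ?thesis
      by (simp add: left_diff_distrib)
  qed
  have diff_bound: "(norm (d u - x u))\<^sup>2 \<le> k * (inner (d u) u - inner (x u) u)"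
    if "d \<in> \<D>" "x \<in> \<D>" "x \<preceq> d" "d \<preceq> d0" for d x u
  proof -
    have "inner ((d - x) v) v \<le> k * (norm v)\<^sup>2" for v
      using form_gap[OF that(4,2)] by (simp add: blinfun.bilinear_simps inner_diff_left)
    moreover have "symmetric_op (d - x)" "0 \<preceq> d - x"
      using that sym by (auto simp: form_le_def blinfun.bilinear_simps inner_diff_left)
    ultimately show ?thesis
      using positive_norm_square_le_form[of "d - x" k u] \<open>k > 0\<close>
      by (simp add: blinfun.bilinear_simps inner_diff_left)
  qed
  have "\<exists>l. ((\<lambda>x. blinfun_apply x u) \<longlongrightarrow> l) F" for u
  proof -
    define i where "i = (INF x\<in>\<D>. inner (blinfun_apply x u) u)"
    have bdd: "bdd_below ((\<lambda>x. inner (blinfun_apply x u) u) ` \<D>)"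
      using bound by (intro bdd_belowI2[of _ "c * inner u u"])
        (auto simp: form_le_def blinfun.bilinear_simps)
    have "cauchy_filter (filtermap (\<lambda>x. blinfun_apply x u) F)"
      unfolding cauchy_filter_metric_filtermap
    proof (intro allI impI)
      fix e :: real assume "e > 0"
      \<comment> \<open>A gap of \<open>\<delta>\<close> between forms means a distance of at most \<open>sqrt (k * \<delta>) = e / 2\<close> between vectors.\<close>
      define \<delta> where "\<delta> = (e / 2)\<^sup>2 / k"
      have "\<delta> > 0"
        using \<open>e > 0\<close> \<open>k > 0\<close> by (simp add: \<delta>_def)
      then obtain d1 where d1: "d1 \<in> \<D>" "inner (d1 u) u < i + \<delta>"
        unfolding i_def using cINF_less_iff[OF ne bdd, of "i + \<delta>"] by (auto simp: i_def)
      obtain d where d: "d \<in> \<D>" "d \<preceq> d1" "d \<preceq> d0"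
        using directed[OF d1(1) d0] by blast
      have close: "norm (d u - x u) < e / 2" if "x \<in> \<D>" "x \<preceq> d" for x
      proof -
        have "i \<le> inner (x u) u"
          unfolding i_def by (rule cINF_lower[OF bdd that(1)])
        moreover have "inner (d u) u < i + \<delta>"
          using d(2) d1(2) by (smt (verit) form_le_def)
        ultimately have "k * (inner (d u) u - inner (x u) u) < k * \<delta>"
          using \<open>k > 0\<close> by (intro mult_strict_left_mono) auto
        then have "(norm (d u - x u))\<^sup>2 < (e / 2)\<^sup>2"
          using diff_bound[OF d(1) that d(3), of u] \<open>k > 0\<close> by (simp add: \<delta>_def)
        then show ?thesis
          by (rule power2_less_imp_less) (use \<open>e > 0\<close> in simp)
      qed
      have "dist (blinfun_apply x u) (blinfun_apply y u) < e"
        if "x \<in> \<D> \<and> x \<preceq> d" "y \<in> \<D> \<and> y \<preceq> d" for x y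
        using close[of x] close[of y] that
        by (metis dist_norm dist_triangle_half_l dist_commute)
      with ev_below[OF d(1)]
      show "\<exists>P. eventually P F \<and> (\<forall>x y. P x \<and> P y \<longrightarrow> dist (blinfun_apply x u) (blinfun_apply y u) < e)"
        by blast
    qed
    then obtain l where "filtermap (\<lambda>x. blinfun_apply x u) F \<le> nhds l"
      using cauchy_filter_complete_converges[OF _ complete_UNIV] \<open>F \<noteq> bot\<close>
      by (metis filtermap_bot_iff principal_UNIV top_greatest)
    then show ?thesis
      by (auto simp: filterlim_def)
  qed
  then obtain g where g: "\<And>u. ((\<lambda>x. blinfun_apply x u) \<longlongrightarrow> g u) F"
    by metis
  have "bounded_linear g"
  proof (rule bounded_linear_intro)
    show "g (u + v) = g u + g v" for u v
      using tendsto_unique[OF \<open>F \<noteq> bot\<close> g[of "u + v"]] tendsto_add[OF g[of u] g[of v]]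
      by (simp add: blinfun.bilinear_simps)
    show "g (r *\<^sub>R u) = r *\<^sub>R g u" for r u
      using tendsto_unique[OF \<open>F \<noteq> bot\<close> g[of "r *\<^sub>R u"]] tendsto_scaleR[OF tendsto_const g[of u]]
      by (simp add: blinfun.bilinear_simps)
    show "norm (g u) \<le> norm u * (norm d0 + k)" for u
    proof (rule tendsto_upperbound[OF tendsto_norm[OF g] _ \<open>F \<noteq> bot\<close>])
      have "norm (blinfun_apply x u) \<le> norm u * (norm d0 + k)" if "x \<in> \<D>" "x \<preceq> d0" for x
      proof -
        have "inner (d0 u) u - inner (x u) u \<le> k * (norm u)\<^sup>2"
          by (rule form_gap[OF le_refl that(1)])
        then have "(norm (d0 u - x u))\<^sup>2 \<le> k * (k * (norm u)\<^sup>2)"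
          using diff_bound[OF d0 that le_refl, of u] \<open>k > 0\<close>
          by (meson mult_left_mono order_trans less_imp_le)
        also have "\<dots> = (k * norm u)\<^sup>2"
          by (simp add: power2_eq_square algebra_simps)
        finally have "norm (d0 u - x u) \<le> k * norm u"
          by (rule power2_le_imp_le) (use \<open>k > 0\<close> in simp)
        then show ?thesis
          using norm_triangle_ineq2[of "x u" "d0 u"] norm_blinfun[of d0 u]
          by (simp add: norm_minus_commute algebra_simps)
      qed
      then show "\<forall>\<^sub>F x in F. norm (blinfun_apply x u) \<le> norm u * (norm d0 + k)"
        using ev_below[OF d0] by (auto elim: eventually_mono)
    qed
  qed
  define G where "G = Blinfun g"
  have G: "((\<lambda>x. blinfun_apply x u) \<longlongrightarrow> G u) F" for u
    using g by (simp add: G_def bounded_linear_Blinfun_apply[OF \<open>bounded_linear g\<close>])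
  have form: "((\<lambda>x. inner (blinfun_apply x u) v) \<longlongrightarrow> inner (G u) v) F" for u v
    by (intro tendsto_intros G)
  show thesis
  proof (rule that)
    have "inner (G u) v = inner u (G v)" for u v
    proof (rule tendsto_unique[OF \<open>F \<noteq> bot\<close> form])
      have "((\<lambda>x. inner u (blinfun_apply x v)) \<longlongrightarrow> inner u (G v)) F"
        by (intro tendsto_intros G)
      moreover have "\<forall>\<^sub>F x in F. inner u (blinfun_apply x v) = inner (blinfun_apply x u) v"
        using ev_in by eventually_elim (simp add: symmetric_opD[OF sym])
      ultimately show "((\<lambda>x. inner (blinfun_apply x u) v) \<longlongrightarrow> inner u (G v)) F"
        using tendsto_cong by fast
    qed
    then show "symmetric_op G"
      by (simp add: symmetric_op_def)
    show "G \<preceq> T" if "T \<in> \<D>" for T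
      unfolding form_le_def
    proof
      fix u
      show "inner (G u) u \<le> inner (T u) u"
        by (rule tendsto_upperbound[OF form _ \<open>F \<noteq> bot\<close>])
          (use ev_below[OF that] in eventually_elim, simp add: form_le_def)
    qed
    show "L \<preceq> G" if "\<And>T. T \<in> \<D> \<Longrightarrow> L \<preceq> T" for L
      unfolding form_le_def
    proof
      fix u
      show "inner (L u) u \<le> inner (G u) u"
        by (rule tendsto_lowerbound[OF form _ \<open>F \<noteq> bot\<close>])
          (use ev_in in eventually_elim, use that in \<open>auto simp: form_le_def\<close>)
    qed
    show "G o\<^sub>L Z = Z o\<^sub>L G" if Z: "\<And>T. T \<in> \<D> \<Longrightarrow> T o\<^sub>L Z = Z o\<^sub>L T" for Z
      unfolding commute_iff_pointwise
    proof
      fix u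
      have "((\<lambda>x. Z (blinfun_apply x u)) \<longlongrightarrow> Z (G u)) F"
        by (intro tendsto_intros G)
      moreover have "\<forall>\<^sub>F x in F. Z (blinfun_apply x u) = x (Z u)"
        using ev_in by eventually_elim (use Z in \<open>simp add: commute_iff_pointwise\<close>)
      ultimately have "((\<lambda>x. blinfun_apply x (Z u)) \<longlongrightarrow> Z (G u)) F"
        using tendsto_cong by fast
      then show "G (Z u) = Z (G u)"
        using tendsto_unique[OF \<open>F \<noteq> bot\<close> G] by blast
    qed
  qed
qed

section \<open>Greatest commuting lower bounds\<close>

text \<open>
  \<open>G\<close> is the infimum of the upper bounds of \<open>\<L>\<close> in the bicommutant, so it commutes with everything
  that commutes with \<open>M\<close> rather than only with \<open>M\<close> itself. That stronger form is what yields
  complex linearity later.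
\<close>

lemma greatest_commuting_lower_bound_symmetric:
  fixes M :: "('a::{real_inner,banach} \<Rightarrow>\<^sub>L 'a) set"
  assumes ne: "M \<noteq> {}" and sym: "\<And>A. A \<in> M \<Longrightarrow> symmetric_op A"
    and comm: "\<And>A B. A \<in> M \<Longrightarrow> B \<in> M \<Longrightarrow> A o\<^sub>L B = B o\<^sub>L A"
    and bound: "\<And>A. A \<in> M \<Longrightarrow> c *\<^sub>R id_blinfun \<preceq> A"
  obtains G where "symmetric_op G" "\<And>A. A \<in> M \<Longrightarrow> G \<preceq> A"
    "\<And>Z. (\<And>A. A \<in> M \<Longrightarrow> A o\<^sub>L Z = Z o\<^sub>L A) \<Longrightarrow> G o\<^sub>L Z = Z o\<^sub>L G"
    "\<And>L. symmetric_op L \<Longrightarrow> (\<And>A. A \<in> M \<Longrightarrow> L \<preceq> A) \<Longrightarrow> (\<And>A. A \<in> M \<Longrightarrow> A o\<^sub>L L = L o\<^sub>L A) \<Longrightarrow> L \<preceq> G"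
proof -
  define comt where "comt = {Z. \<forall>A\<in>M. A o\<^sub>L Z = Z o\<^sub>L A}"
  define \<L> where "\<L> = {L \<in> comt. symmetric_op L \<and> (\<forall>A\<in>M. L \<preceq> A)}"
  define \<D> where "\<D> = {T. symmetric_op T \<and> (\<forall>Z\<in>comt. T o\<^sub>L Z = Z o\<^sub>L T) \<and> (\<forall>L\<in>\<L>. L \<preceq> T)}"
  \<comment> \<open>Pairwise commutation enters here: it makes the members of \<open>\<D>\<close> commute with each other.\<close>
  have "M \<subseteq> comt"
    using comm by (auto simp: comt_def)
  have "M \<subseteq> \<D>"
    using sym by (auto simp: \<D>_def \<L>_def comt_def)
  have "c *\<^sub>R id_blinfun \<in> \<L>"
    using bound by (auto simp: \<L>_def comt_def commute_iff_pointwise blinfun.bilinear_simps)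
  have directed: "\<exists>W\<in>\<D>. W \<preceq> S \<and> W \<preceq> T" if "S \<in> \<D>" "T \<in> \<D>" for S T
  proof -
    have "T \<in> comt"
      using that(2) \<open>M \<subseteq> comt\<close> by (auto simp: \<D>_def comt_def)
    then have ST: "symmetric_op S" "symmetric_op T" "S o\<^sub>L T = T o\<^sub>L S"
      using that by (auto simp: \<D>_def)
    obtain W where W: "symmetric_op W" "W \<preceq> S" "W \<preceq> T"
      and W_comm: "\<And>Z. S o\<^sub>L Z = Z o\<^sub>L S \<Longrightarrow> T o\<^sub>L Z = Z o\<^sub>L T \<Longrightarrow> W o\<^sub>L Z = Z o\<^sub>L W"
      and W_greatest: "\<And>L. symmetric_op L \<Longrightarrow> S o\<^sub>L L = L o\<^sub>L S \<Longrightarrow> T o\<^sub>L L = L o\<^sub>L T \<Longrightarrow>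
        L \<preceq> S \<Longrightarrow> L \<preceq> T \<Longrightarrow> L \<preceq> W"
      using commuting_min_exists[OF ST] by metis
    have "W \<in> \<D>"
      using that W(1) W_comm W_greatest by (auto simp: \<D>_def \<L>_def)
    with W(2,3) show ?thesis by blast
  qed
  obtain G where G: "symmetric_op G" "\<And>T. T \<in> \<D> \<Longrightarrow> G \<preceq> T"
    "\<And>L. (\<And>T. T \<in> \<D> \<Longrightarrow> L \<preceq> T) \<Longrightarrow> L \<preceq> G"
    "\<And>Z. (\<And>T. T \<in> \<D> \<Longrightarrow> T o\<^sub>L Z = Z o\<^sub>L T) \<Longrightarrow> G o\<^sub>L Z = Z o\<^sub>L G"
  proof (rule directed_infimum_exists[of \<D> c])
    show "\<D> \<noteq> {}"
      using ne \<open>M \<subseteq> \<D>\<close> by blast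
    show "c *\<^sub>R id_blinfun \<preceq> T" if "T \<in> \<D>" for T
      using that \<open>c *\<^sub>R id_blinfun \<in> \<L>\<close> by (auto simp: \<D>_def)
  qed (use directed in \<open>auto simp: \<D>_def\<close>)
  show thesis
  proof (rule that[OF G(1)])
    show "G \<preceq> A" if "A \<in> M" for A
      using that G(2) \<open>M \<subseteq> \<D>\<close> by blast
    show "G o\<^sub>L Z = Z o\<^sub>L G" if "\<And>A. A \<in> M \<Longrightarrow> A o\<^sub>L Z = Z o\<^sub>L A" for Z
      using that by (intro G(4)) (auto simp: \<D>_def comt_def)
    show "L \<preceq> G" if "symmetric_op L" "\<And>A. A \<in> M \<Longrightarrow> L \<preceq> A" "\<And>A. A \<in> M \<Longrightarrow> A o\<^sub>L L = L o\<^sub>L A" for L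
      using that by (intro G(3)) (auto simp: \<D>_def \<L>_def comt_def)
  qed
qed

section \<open>Passage to the complex Hilbert space\<close>

instance complex_hilbert_space \<subseteq> banach ..

lemma loewner_le_iff_form_le: "S \<le>\<^sub>L T \<longleftrightarrow> S \<preceq> T"
  by (simp add: loewner_le_def form_le_def inner_eq_Re_cinner)

lemma self_adjoint_imp_symmetric: "S \<in> self_adjoint_ops \<Longrightarrow> symmetric_op S"
  by (simp add: self_adjoint_ops_def symmetric_op_def inner_eq_Re_cinner)

lemma Im_cinner: "Im (cinner x y) = - inner (\<i> *\<^sub>C x) (y::'a::complex_inner)"
  by (simp add: inner_eq_Re_cinner cinner_scaleC_left)

text \<open>The real part of the inner product determines the imaginary part through multiplication by \<open>\<i>\<close>.\<close>

lemma self_adjointI: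
  fixes S :: "'a::complex_hilbert_space \<Rightarrow>\<^sub>L 'a"
  assumes S: "symmetric_op S" and hom: "\<And>c x. S (c *\<^sub>C x) = c *\<^sub>C S x"
  shows "S \<in> self_adjoint_ops"
proof -
  have "cinner (S u) v = cinner u (S v)" for u v
  proof (rule complex_eqI)
    show "Re (cinner (S u) v) = Re (cinner u (S v))"
      using symmetric_opD[OF S, of u v] by (simp add: inner_eq_Re_cinner)
    show "Im (cinner (S u) v) = Im (cinner u (S v))"
      using symmetric_opD[OF S, of "\<i> *\<^sub>C u" v] by (simp add: Im_cinner hom)
  qed
  with hom show ?thesis
    by (simp add: self_adjoint_ops_def)
qed

lemma norm_scaleC: "norm (c *\<^sub>C x) = cmod c * norm (x::'a::complex_inner)"
proof -
  have "cinner x (c *\<^sub>C x) = cnj c * cinner x x"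
    by (metis cinner_commute cinner_scaleC_left complex_cnj_mult)
  then have "complex_of_real ((norm (c *\<^sub>C x))\<^sup>2) = complex_of_real ((cmod c * norm x)\<^sup>2)"
    unfolding cinner_self[symmetric] cinner_scaleC_left
    using complex_norm_square[of c] by (simp add: cinner_self power_mult_distrib)
  then have "(norm (c *\<^sub>C x))\<^sup>2 = (cmod c * norm x)\<^sup>2"
    by (simp only: of_real_eq_iff)
  then show ?thesis
    by (simp add: power2_eq_iff_nonneg)
qed

lemma bounded_linear_scaleC: "bounded_linear (\<lambda>x::'a::complex_inner. c *\<^sub>C x)"
  by (rule bounded_linear_intro[where K = "cmod c"])
    (simp_all add: scaleC_add_right norm_scaleC scaleR_scaleC scaleC_scaleC mult.commute)

theorem theorem6p4:
  fixes M :: "('a::complex_hilbert_space \<Rightarrow>\<^sub>L 'a) set"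
  assumes "M \<subseteq> self_adjoint_ops"
    and "M \<noteq> {}"
    and "bounded_from_below M"
    and "\<forall>A\<in>M. \<forall>B\<in>M. A o\<^sub>L B = B o\<^sub>L A"
  shows "\<exists>G. greatest_element (commuting_lower_bounds M) G"
proof -
  obtain L0 where L0: "\<And>A. A \<in> M \<Longrightarrow> L0 \<preceq> A"
    using assms(3) by (auto simp: bounded_from_below_def lower_bounds_def loewner_le_iff_form_le)
  have "(- norm L0) *\<^sub>R id_blinfun \<preceq> L0"
    unfolding form_le_def
  proof
    fix u
    have "\<bar>inner (L0 u) u\<bar> \<le> norm (L0 u) * norm u"
      by (rule Cauchy_Schwarz_ineq2)
    also have "\<dots> \<le> norm L0 * norm u * norm u"
      by (intro mult_right_mono norm_blinfun) simp
    finally show "inner (((- norm L0) *\<^sub>R id_blinfun) u) u \<le> inner (L0 u) u"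
      by (simp add: blinfun.bilinear_simps norm_eq_sqrt_inner mult.assoc)
  qed
  then have bound: "(- norm L0) *\<^sub>R id_blinfun \<preceq> A" if "A \<in> M" for A
    using L0[OF that] by (meson form_le_def order_trans)
  have sym: "\<And>A. A \<in> M \<Longrightarrow> symmetric_op A"
    using assms(1) self_adjoint_imp_symmetric by blast
  have comm: "\<And>A B. A \<in> M \<Longrightarrow> B \<in> M \<Longrightarrow> A o\<^sub>L B = B o\<^sub>L A"
    using assms(4) by blast
  obtain G where G: "symmetric_op G" "\<And>A. A \<in> M \<Longrightarrow> G \<preceq> A"
    and G_comm: "\<And>Z. (\<And>A. A \<in> M \<Longrightarrow> A o\<^sub>L Z = Z o\<^sub>L A) \<Longrightarrow> G o\<^sub>L Z = Z o\<^sub>L G"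
    and G_greatest: "\<And>L. symmetric_op L \<Longrightarrow> (\<And>A. A \<in> M \<Longrightarrow> L \<preceq> A) \<Longrightarrow>
      (\<And>A. A \<in> M \<Longrightarrow> A o\<^sub>L L = L o\<^sub>L A) \<Longrightarrow> L \<preceq> G"
    using greatest_commuting_lower_bound_symmetric[OF assms(2) sym comm bound] by blast
  \<comment> \<open>Scalar multiplication is in the commutant of \<open>M\<close>, and \<open>G\<close> is in the bicommutant.\<close>
  have "G (c *\<^sub>C x) = c *\<^sub>C G x" for c x
  proof -
    let ?Z = "Blinfun (\<lambda>x::'a. c *\<^sub>C x)"
    have Z: "blinfun_apply ?Z = (\<lambda>x. c *\<^sub>C x)"
      by (rule bounded_linear_Blinfun_apply[OF bounded_linear_scaleC])
    have "G o\<^sub>L ?Z = ?Z o\<^sub>L G"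
      using assms(1) by (intro G_comm) (auto simp: commute_iff_pointwise Z self_adjoint_ops_def)
    then show ?thesis
      by (simp add: commute_iff_pointwise Z)
  qed
  then have "G \<in> self_adjoint_ops"
    using G(1) self_adjointI by blast
  moreover have "A o\<^sub>L G = G o\<^sub>L A" if "A \<in> M" for A
    using G_comm[of A] assms(4) that by simp
  ultimately have "G \<in> commuting_lower_bounds M"
    using G(2) by (simp add: commuting_lower_bounds_def lower_bounds_def loewner_le_iff_form_le)
  moreover have "L \<le>\<^sub>L G" if "L \<in> commuting_lower_bounds M" for L
    using that G_greatest[of L] self_adjoint_imp_symmetric[of L]
    by (simp add: commuting_lower_bounds_def lower_bounds_def loewner_le_iff_form_le)
  ultimately show ?thesis
    unfolding greatest_element_def by blast
qed

end
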